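(* Let $G$ be a finite simple graph. If $G$ is Sidorenko, then for every integer $m \ge 2$ the $m$-fold blow-up of $G$ is forcing.
   Context: All graphs are finite and simple; $V_G$, $E_G$ denote vertex and edge sets and $e_G=|E_G|$. For graphs $G,H$, $t(G,H)$ is the probability that a uniformly random map $\phi:V_G\to V_H$ is a graph homomorphism, i.e. $\{\phi(u),\phi(v)\}\in E_H$ for every $\{u,v\}\in E_G$. $K_2$ is a single edge. A graph $G$ is Sidorenko if $t(G,H)\ge t(K_2,H)^{e_G}$ for every graph $H$. A sequence of graphs $(H_n)_{n\in\mathbb N}$ of increasing order (number of vertices) is $p$-quasi-random if $t(J,H_n)=(1+o(1))\,p^{e_J}$ for every graph $J$. A graph $G$ is forcing if, for every $p\in[0,1]$, every sequence $(H_n)_{n\in\mathbb N}$ of graphs of increasing order with $t(K_2,H_n)=(1+o(1))\,p$ and $t(G,H_n)=(1+o(1))\,p^{e_G}$ is $p$-quasi-random. The $m$-fold blow-up of $G$ is the graph on vertex set $V_G\times[m]$, $[m]=\{1,\dots,m\}$, in which $(v,i)$ and $(w,j)$ are adjacent if and only if $v$ and $w$ are adjacent in $G$.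
   Formalization: The graph G is assumed to have at least one edge; for edgeless G the claim fails, since G is trivially Sidorenko but its edgeless blow-up is not forcing (e.g. K_{n,n} with p = 1/2 contains no triangles). *)

theory Defs
  imports Complex_Main "HOL-Library.FuncSet" "HOL-Library.Landau_Symbols"
begin

record 'a sgraph =
  verts :: "'a set"
  edges :: "'a set set"

definition finite_simple_graph :: "'a sgraph \<Rightarrow> bool" where
  "finite_simple_graph G \<longleftrightarrow>
     finite (verts G) \<and> edges G \<subseteq> {e. e \<subseteq> verts G \<and> card e = 2}"

definition K2 :: "nat sgraph" where
  "K2 = \<lparr>verts = {0, 1}, edges = {{0, 1}}\<rparr>"

text \<open>
  Maps \<open>V\<^sub>G \<rightarrow> V\<^sub>H\<close> are extensional functions, so that there are exactly
  \<open>|V\<^sub>H| ^ |V\<^sub>G|\<close> of them.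
\<close>

definition graph_homs :: "'a sgraph \<Rightarrow> 'b sgraph \<Rightarrow> ('a \<Rightarrow> 'b) set" where
  "graph_homs G H =
     {\<phi> \<in> verts G \<rightarrow>\<^sub>E verts H. \<forall>u v. {u, v} \<in> edges G \<longrightarrow> {\<phi> u, \<phi> v} \<in> edges H}"

definition hom_density :: "'a sgraph \<Rightarrow> 'b sgraph \<Rightarrow> real" where
  "hom_density G H = real (card (graph_homs G H)) / real (card (verts G \<rightarrow>\<^sub>E verts H))"

text \<open>
  Quantification over all finite graphs is rendered as quantification over the finite graphs
  with vertices in \<^typ>\<open>nat\<close>, which represent all isomorphism types; the lemmas at the end
  transfer the definitions to graphs over arbitrary vertex types. Host graphs are nonempty,
  since otherwise there is no random map into them.
\<close>

definition sidorenko :: "'a sgraph \<Rightarrow> bool" where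
  "sidorenko G \<longleftrightarrow>
     (\<forall>H :: nat sgraph. finite_simple_graph H \<and> verts H \<noteq> {} \<longrightarrow>
        hom_density G H \<ge> hom_density K2 H ^ card (edges G))"

definition increasing_graph_seq :: "(nat \<Rightarrow> 'b sgraph) \<Rightarrow> bool" where
  "increasing_graph_seq H \<longleftrightarrow>
     (\<forall>n. finite_simple_graph (H n) \<and> verts (H n) \<noteq> {}) \<and>
     strict_mono (\<lambda>n. card (verts (H n)))"

text \<open>
  The relation \<open>f = (1 + o(1)) g\<close> is asymptotic equivalence; for \<open>g = 0\<close> it says that \<open>f\<close> is
  eventually \<open>0\<close>.
\<close>

definition quasi_random :: "real \<Rightarrow> (nat \<Rightarrow> 'b sgraph) \<Rightarrow> bool" where
  "quasi_random p H \<longleftrightarrow>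
     increasing_graph_seq H \<and>
     (\<forall>J :: nat sgraph. finite_simple_graph J \<longrightarrow>
        (\<lambda>n. hom_density J (H n)) \<sim>[sequentially] (\<lambda>n. p ^ card (edges J)))"

definition forcing :: "'a sgraph \<Rightarrow> bool" where
  "forcing G \<longleftrightarrow>
     (\<forall>p \<in> {0..1}. \<forall>H :: nat \<Rightarrow> nat sgraph.
        increasing_graph_seq H \<and>
        (\<lambda>n. hom_density K2 (H n)) \<sim>[sequentially] (\<lambda>n. p) \<and>
        (\<lambda>n. hom_density G (H n)) \<sim>[sequentially] (\<lambda>n. p ^ card (edges G)) \<longrightarrow>
        quasi_random p H)"

definition blow_up :: "nat \<Rightarrow> 'a sgraph \<Rightarrow> ('a \<times> nat) sgraph" where
  "blow_up m G =
     \<lparr>verts = verts G \<times> {1..m},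
      edges = {{(v, i), (w, j)} | v w i j. {v, w} \<in> edges G \<and> i \<in> {1..m} \<and> j \<in> {1..m}}\<rparr>"

lemma finite_simple_graph_blow_up:
  assumes "finite_simple_graph G"
  shows "finite_simple_graph (blow_up m G)"
proof -
  have edge: "v \<in> verts G \<and> w \<in> verts G \<and> v \<noteq> w" if "{v, w} \<in> edges G" for v w
  proof -
    have "{v, w} \<subseteq> verts G" "card {v, w} = 2"
      using assms that unfolding finite_simple_graph_def by blast+
    then show ?thesis by (cases "v = w") auto
  qed
  have "e \<subseteq> verts (blow_up m G) \<and> card e = 2" if e: "e \<in> edges (blow_up m G)" for e
  proof -
    obtain v w i j where e: "e = {(v, i), (w, j)}" and vw: "{v, w} \<in> edges G"
      and ij: "i \<in> {1..m}" "j \<in> {1..m}"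
      using e unfolding blow_up_def by auto
    show ?thesis using edge[OF vw] ij by (simp add: e blow_up_def)
  qed
  moreover have "finite (verts (blow_up m G))"
    using assms by (simp add: finite_simple_graph_def blow_up_def)
  ultimately show ?thesis unfolding finite_simple_graph_def by blast
qed

definition relabel :: "('a \<Rightarrow> 'b) \<Rightarrow> 'a sgraph \<Rightarrow> 'b sgraph" where
  "relabel f G = \<lparr>verts = f ` verts G, edges = (`) f ` edges G\<rparr>"

lemma finite_simple_graph_relabel:
  assumes "finite_simple_graph G" "inj_on f (verts G)"
  shows "finite_simple_graph (relabel f G)"
proof -
  have "card (f ` e) = 2" if "e \<in> edges G" for e
  proof -
    have "e \<subseteq> verts G" "card e = 2"
      using assms(1) that unfolding finite_simple_graph_def by blast+
    then show ?thesis
      using assms(2) by (simp add: card_image inj_on_subset)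
  qed
  then show ?thesis
    using assms by (auto simp: finite_simple_graph_def relabel_def)
qed

lemma card_verts_relabel:
  "inj_on f (verts G) \<Longrightarrow> card (verts (relabel f G)) = card (verts G)"
  by (simp add: relabel_def card_image)

lemma card_edges_relabel:
  assumes "finite_simple_graph G" "inj_on f (verts G)"
  shows "card (edges (relabel f G)) = card (edges G)"
proof -
  have "edges G \<subseteq> Pow (verts G)"
    using assms by (auto simp: finite_simple_graph_def)
  then have "inj_on ((`) f) (edges G)"
    using assms(2) by (meson inj_on_image_Pow inj_on_subset)
  then show ?thesis by (simp add: relabel_def card_image)
qed

lemma edge_relabel_iff:
  assumes "finite_simple_graph G" "inj_on f (verts G)" "u \<in> verts G" "v \<in> verts G"
  shows "{f u, f v} \<in> edges (relabel f G) \<longleftrightarrow> {u, v} \<in> edges G"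
proof
  assume "{f u, f v} \<in> edges (relabel f G)"
  then obtain e where e: "e \<in> edges G" "f ` {u, v} = f ` e"
    by (auto simp: relabel_def)
  moreover have "e \<subseteq> verts G" using assms(1) e(1) by (auto simp: finite_simple_graph_def)
  ultimately have "{u, v} = e"
    using assms by (metis empty_subsetI inj_on_image_eq_iff insert_subset)
  then show "{u, v} \<in> edges G" using e by simp
next
  assume "{u, v} \<in> edges G"
  then have "f ` {u, v} \<in> (`) f ` edges G" by (rule imageI)
  then show "{f u, f v} \<in> edges (relabel f G)" by (simp add: relabel_def)
qed

lemma edge_vertsD:
  "finite_simple_graph G \<Longrightarrow> {u, v} \<in> edges G \<Longrightarrow> u \<in> verts G \<and> v \<in> verts G"
  by (auto simp: finite_simple_graph_def)

lemma hom_density_relabel_target: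
  assumes G: "finite_simple_graph G" and H: "finite_simple_graph H"
    and f: "inj_on f (verts H)"
  shows "hom_density G (relabel f H) = hom_density G H"
proof -
  define F where "F \<phi> = restrict (f \<circ> \<phi>) (verts G)" for \<phi> :: "'a \<Rightarrow> 'b"
  have bij: "bij_betw F (verts G \<rightarrow>\<^sub>E verts H) (verts G \<rightarrow>\<^sub>E verts (relabel f H))"
  proof (rule bij_betwI[where g = "\<lambda>\<psi>. restrict (inv_into (verts H) f \<circ> \<psi>) (verts G)"])
    show "F \<in> (verts G \<rightarrow>\<^sub>E verts H) \<rightarrow> (verts G \<rightarrow>\<^sub>E verts (relabel f H))"
      by (auto simp: F_def relabel_def)
    show "(\<lambda>\<psi>. restrict (inv_into (verts H) f \<circ> \<psi>) (verts G))
        \<in> (verts G \<rightarrow>\<^sub>E verts (relabel f H)) \<rightarrow> (verts G \<rightarrow>\<^sub>E verts H)"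
      using f by (force simp: relabel_def PiE_iff intro: inv_into_into)
    show "restrict (inv_into (verts H) f \<circ> F \<phi>) (verts G) = \<phi>"
      if "\<phi> \<in> verts G \<rightarrow>\<^sub>E verts H" for \<phi>
      using f that by (auto simp: F_def fun_eq_iff PiE_iff extensional_def restrict_def)
    show "F (restrict (inv_into (verts H) f \<circ> \<psi>) (verts G)) = \<psi>"
      if "\<psi> \<in> verts G \<rightarrow>\<^sub>E verts (relabel f H)" for \<psi>
      using that
      by (auto simp: F_def fun_eq_iff PiE_iff extensional_def restrict_def relabel_def f_inv_into_f)
  qed
  have iff: "F \<phi> \<in> graph_homs G (relabel f H) \<longleftrightarrow> \<phi> \<in> graph_homs G H"
    if \<phi>: "\<phi> \<in> verts G \<rightarrow>\<^sub>E verts H" for \<phi>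
  proof -
    have "F \<phi> \<in> verts G \<rightarrow>\<^sub>E verts (relabel f H)" using bij \<phi> by (rule bij_betw_apply)
    moreover have "{F \<phi> u, F \<phi> v} \<in> edges (relabel f H) \<longleftrightarrow> {\<phi> u, \<phi> v} \<in> edges H"
      if "{u, v} \<in> edges G" for u v
    proof -
      have uv: "u \<in> verts G" "v \<in> verts G" using edge_vertsD[OF G that] by auto
      then have "\<phi> u \<in> verts H" "\<phi> v \<in> verts H" using \<phi> by auto
      from edge_relabel_iff[OF H f this] show ?thesis using uv by (simp add: F_def)
    qed
    ultimately show ?thesis using \<phi> by (auto simp: graph_homs_def)
  qed
  have "bij_betw F (graph_homs G H) (graph_homs G (relabel f H))"
    unfolding bij_betw_def
  proof
    show "inj_on F (graph_homs G H)"
      using bij_betw_imp_inj_on[OF bij] by (rule inj_on_subset) (auto simp: graph_homs_def)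
    show "F ` graph_homs G H = graph_homs G (relabel f H)"
    proof (intro equalityI subsetI)
      fix \<psi> assume "\<psi> \<in> F ` graph_homs G H"
      then show "\<psi> \<in> graph_homs G (relabel f H)"
        using iff by (auto simp: graph_homs_def)
    next
      fix \<psi> assume \<psi>: "\<psi> \<in> graph_homs G (relabel f H)"
      then have "\<psi> \<in> verts G \<rightarrow>\<^sub>E verts (relabel f H)" by (simp add: graph_homs_def)
      then obtain \<phi> where "\<phi> \<in> verts G \<rightarrow>\<^sub>E verts H" "\<psi> = F \<phi>"
        using bij_betw_imp_surj_on[OF bij] by blast
      then show "\<psi> \<in> F ` graph_homs G H" using iff \<psi> by blast
    qed
  qed
  then show ?thesis
    using bij by (simp add: hom_density_def bij_betw_same_card)
qed

lemma hom_density_relabel_source: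
  assumes G: "finite_simple_graph G" and f: "inj_on f (verts G)"
  shows "hom_density (relabel f G) H = hom_density G H"
proof -
  define F where "F \<psi> = restrict (\<psi> \<circ> f) (verts G)" for \<psi> :: "'b \<Rightarrow> 'c"
  have bij: "bij_betw F (verts (relabel f G) \<rightarrow>\<^sub>E verts H) (verts G \<rightarrow>\<^sub>E verts H)"
  proof (rule bij_betwI[where g = "\<lambda>\<phi>. restrict (\<phi> \<circ> inv_into (verts G) f) (f ` verts G)"])
    show "F \<in> (verts (relabel f G) \<rightarrow>\<^sub>E verts H) \<rightarrow> (verts G \<rightarrow>\<^sub>E verts H)"
      by (auto simp: F_def relabel_def)
    show "(\<lambda>\<phi>. restrict (\<phi> \<circ> inv_into (verts G) f) (f ` verts G))
        \<in> (verts G \<rightarrow>\<^sub>E verts H) \<rightarrow> (verts (relabel f G) \<rightarrow>\<^sub>E verts H)"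
      using f by (auto simp: relabel_def)
    show "restrict (F \<psi> \<circ> inv_into (verts G) f) (f ` verts G) = \<psi>"
      if "\<psi> \<in> verts (relabel f G) \<rightarrow>\<^sub>E verts H" for \<psi>
      using f that
      by (auto simp: F_def fun_eq_iff PiE_iff extensional_def restrict_def relabel_def)
    show "F (restrict (\<phi> \<circ> inv_into (verts G) f) (f ` verts G)) = \<phi>"
      if "\<phi> \<in> verts G \<rightarrow>\<^sub>E verts H" for \<phi>
      using f that by (auto simp: F_def fun_eq_iff PiE_iff extensional_def restrict_def)
  qed
  have iff: "F \<psi> \<in> graph_homs G H \<longleftrightarrow> \<psi> \<in> graph_homs (relabel f G) H"
    if \<psi>: "\<psi> \<in> verts (relabel f G) \<rightarrow>\<^sub>E verts H" for \<psi>
  proof -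
    have "F \<psi> \<in> verts G \<rightarrow>\<^sub>E verts H" using bij \<psi> by (rule bij_betw_apply)
    moreover have "(\<forall>u v. {u, v} \<in> edges G \<longrightarrow> {F \<psi> u, F \<psi> v} \<in> edges H) \<longleftrightarrow>
        (\<forall>x y. {x, y} \<in> edges (relabel f G) \<longrightarrow> {\<psi> x, \<psi> y} \<in> edges H)" (is "?A \<longleftrightarrow> ?B")
    proof
      assume A: ?A
      show ?B
      proof (intro allI impI)
        fix x y assume xy: "{x, y} \<in> edges (relabel f G)"
        then have "x \<in> f ` verts G \<and> y \<in> f ` verts G"
          using edge_vertsD[OF finite_simple_graph_relabel[OF G f] xy] by (simp add: relabel_def)
        then obtain u v where uv: "u \<in> verts G" "v \<in> verts G" "x = f u" "y = f v" by auto
        then show "{\<psi> x, \<psi> y} \<in> edges H"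
          using A xy edge_relabel_iff[OF G f uv(1,2)] by (force simp: F_def)
      qed
    next
      assume B: ?B
      show ?A
      proof (intro allI impI)
        fix u v assume uv: "{u, v} \<in> edges G"
        then have "u \<in> verts G" "v \<in> verts G" using edge_vertsD[OF G] by auto
        then show "{F \<psi> u, F \<psi> v} \<in> edges H"
          using B uv edge_relabel_iff[OF G f] by (simp add: F_def)
      qed
    qed
    ultimately show ?thesis using \<psi> by (simp add: graph_homs_def)
  qed
  have "bij_betw F (graph_homs (relabel f G) H) (graph_homs G H)"
    unfolding bij_betw_def
  proof
    show "inj_on F (graph_homs (relabel f G) H)"
      using bij_betw_imp_inj_on[OF bij] by (rule inj_on_subset) (auto simp: graph_homs_def)
    show "F ` graph_homs (relabel f G) H = graph_homs G H"
    proof (intro equalityI subsetI)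
      fix \<phi> assume "\<phi> \<in> F ` graph_homs (relabel f G) H"
      then show "\<phi> \<in> graph_homs G H"
        using iff by (auto simp: graph_homs_def)
    next
      fix \<phi> assume \<phi>: "\<phi> \<in> graph_homs G H"
      then have "\<phi> \<in> verts G \<rightarrow>\<^sub>E verts H" by (simp add: graph_homs_def)
      then obtain \<psi> where "\<psi> \<in> verts (relabel f G) \<rightarrow>\<^sub>E verts H" "\<phi> = F \<psi>"
        using bij_betw_imp_surj_on[OF bij] by blast
      then show "\<phi> \<in> F ` graph_homs (relabel f G) H" using iff \<phi> by blast
    qed
  qed
  then show ?thesis
    using bij by (simp add: hom_density_def bij_betw_same_card)
qed

lemma ex_nat_labelling:
  assumes "finite_simple_graph G"
  shows "\<exists>f :: 'a \<Rightarrow> nat. inj_on f (verts (G :: 'a sgraph))"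
  using assms finite_imp_inj_to_nat_seg[of "verts G"]
  unfolding finite_simple_graph_def by blast

lemma finite_simple_graph_K2: "finite_simple_graph K2"
  by (auto simp: finite_simple_graph_def K2_def)

lemma sidorenkoD:
  fixes H :: "'b sgraph"
  assumes "sidorenko G" "finite_simple_graph G" "finite_simple_graph H" "verts H \<noteq> {}"
  shows "hom_density G H \<ge> hom_density K2 H ^ card (edges G)"
proof -
  obtain f :: "'b \<Rightarrow> nat" where f: "inj_on f (verts H)"
    using ex_nat_labelling[OF assms(3)] by blast
  have "hom_density G (relabel f H) \<ge> hom_density K2 (relabel f H) ^ card (edges G)"
    using assms(1,4) finite_simple_graph_relabel[OF assms(3) f]
    by (simp add: sidorenko_def relabel_def)
  then show ?thesis
    using assms f by (simp add: hom_density_relabel_target finite_simple_graph_K2)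
qed

lemma quasi_randomD:
  fixes J :: "'a sgraph"
  assumes "quasi_random p H" "finite_simple_graph J"
  shows "(\<lambda>n. hom_density J (H n)) \<sim>[sequentially] (\<lambda>n. p ^ card (edges J))"
proof -
  obtain f :: "'a \<Rightarrow> nat" where f: "inj_on f (verts J)"
    using ex_nat_labelling[OF assms(2)] by blast
  have "(\<lambda>n. hom_density (relabel f J) (H n)) \<sim>[sequentially] (\<lambda>n. p ^ card (edges (relabel f J)))"
    using assms(1) finite_simple_graph_relabel[OF assms(2) f] by (simp add: quasi_random_def)
  then show ?thesis
    using assms(2) f by (simp add: hom_density_relabel_source card_edges_relabel)
qed

lemma forcingD:
  fixes H :: "nat \<Rightarrow> 'b sgraph"
  assumes "forcing G" "finite_simple_graph G" "p \<in> {0..1}" "increasing_graph_seq H"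
    and "(\<lambda>n. hom_density K2 (H n)) \<sim>[sequentially] (\<lambda>n. p)"
    and "(\<lambda>n. hom_density G (H n)) \<sim>[sequentially] (\<lambda>n. p ^ card (edges G))"
  shows "quasi_random p H"
proof -
  have H: "finite_simple_graph (H n)" for n
    using assms(4) by (simp add: increasing_graph_seq_def)
  obtain f :: "nat \<Rightarrow> 'b \<Rightarrow> nat" where f: "\<And>n. inj_on (f n) (verts (H n))"
    using ex_nat_labelling[OF H] by metis
  define H' where "H' n = relabel (f n) (H n)" for n
  have dens_nat: "hom_density J (H' n) = hom_density J (H n)" if "finite_simple_graph J"
    for J :: "nat sgraph" and n
    unfolding H'_def using that H f by (rule hom_density_relabel_target)
  have densG: "hom_density G (H' n) = hom_density G (H n)" for n
    unfolding H'_def using assms(2) H f by (rule hom_density_relabel_target)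
  have "card (verts (H' n)) = card (verts (H n))" for n
    unfolding H'_def using f by (rule card_verts_relabel)
  moreover have "finite_simple_graph (H' n)" for n
    unfolding H'_def using H f by (rule finite_simple_graph_relabel)
  ultimately have "increasing_graph_seq H'"
    using assms(4) by (simp add: increasing_graph_seq_def) (simp add: H'_def relabel_def)
  then have "quasi_random p H'"
    using assms(1,3,5,6) dens_nat[OF finite_simple_graph_K2] densG by (simp add: forcing_def)
  then show ?thesis
    using assms(4) dens_nat by (simp add: quasi_random_def)
qed

end

theory Submission
  imports Defs "HOL-Library.Indicator_Function" "HOL-Analysis.Convex"
begin

text \<open>
  Let \<open>H\<^sup>(\<^sup>m\<^sup>)\<close> be the graph on \<open>V\<^sub>H\<^sup>m\<close> in which \<open>x\<close> and \<open>y\<close> are adjacent iff all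
  \<open>x\<^sub>i y\<^sub>j\<close> are edges of \<open>H\<close>. Writing \<open>G(m)\<close> for the blow-up, \<open>t(G(m), H) = t(G, H\<^sup>(\<^sup>m\<^sup>))\<close>, and
  since \<open>G\<close> is Sidorenko this is at least \<open>t(K\<^sub>2, H\<^sup>(\<^sup>m\<^sup>)) = t(K\<^sub>m\<^sub>,\<^sub>m, H)\<close> to the power \<open>e\<^sub>G\<close>.
  By the power mean inequality, \<open>t(K\<^sub>s\<^sub>,\<^sub>t, H)\<close> to the power \<open>1/(st)\<close> is monotone in \<open>s\<close> and
  \<open>t\<close>; comparing \<open>K\<^sub>1\<^sub>,\<^sub>1\<close>, \<open>K\<^sub>2\<^sub>,\<^sub>2 = C\<^sub>4\<close> and \<open>K\<^sub>m\<^sub>,\<^sub>m\<close> squeezes \<open>t(C\<^sub>4, H\<^sub>n)\<close> to \<open>p\<^sup>4\<close>.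
  Then the codegrees of \<open>H\<^sub>n\<close> recentred by \<open>p\<close> tend to \<open>0\<close> in mean square, which by
  Cauchy-Schwarz lets one replace the edges of any \<open>J\<close> one after the other by the constant \<open>p\<close>.
\<close>

section \<open>Averages and power means\<close>

definition avg :: "'a set \<Rightarrow> ('a \<Rightarrow> real) \<Rightarrow> real" where
  "avg S f = (\<Sum>x\<in>S. f x) / real (card S)"

lemma avg_cong: "S = T \<Longrightarrow> (\<And>x. x \<in> T \<Longrightarrow> f x = g x) \<Longrightarrow> avg S f = avg T g"
  by (simp add: avg_def cong: sum.cong)

lemma avg_const: "finite S \<Longrightarrow> S \<noteq> {} \<Longrightarrow> avg S (\<lambda>_. c) = c"
  by (simp add: avg_def)

lemma avg_add: "avg S (\<lambda>x. f x + g x) = avg S f + avg S g"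
  by (simp add: avg_def sum.distrib add_divide_distrib)

lemma avg_diff: "avg S (\<lambda>x. f x - g x) = avg S f - avg S g"
  by (simp add: avg_def sum_subtractf diff_divide_distrib)

lemma avg_cmult: "avg S (\<lambda>x. c * f x) = c * avg S f"
  by (simp add: avg_def sum_distrib_left)

lemma avg_mono: "(\<And>x. x \<in> S \<Longrightarrow> f x \<le> g x) \<Longrightarrow> avg S f \<le> avg S g"
  by (simp add: avg_def sum_mono divide_right_mono)

lemma avg_nonneg: "(\<And>x. x \<in> S \<Longrightarrow> 0 \<le> f x) \<Longrightarrow> 0 \<le> avg S f"
  by (simp add: avg_def sum_nonneg)

lemma avg_abs_le:
  assumes "finite S" "S \<noteq> {}" "\<And>x. x \<in> S \<Longrightarrow> \<bar>f x\<bar> \<le> c"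
  shows "\<bar>avg S f\<bar> \<le> c"
proof -
  have "avg S f \<le> avg S (\<lambda>_. c)" "avg S (\<lambda>_. -c) \<le> avg S f"
    using assms(3) by (intro avg_mono; force)+
  then show ?thesis using assms by (simp add: avg_const)
qed

lemma avg_swap: "avg A (\<lambda>a. avg B (f a)) = avg B (\<lambda>b. avg A (\<lambda>a. f a b))"
  by (simp add: avg_def sum_divide_distrib[symmetric] mult.commute sum.swap[where A = A])

lemma avg_mult: "avg A f * avg B g = avg A (\<lambda>a. avg B (\<lambda>b. f a * g b))"
  by (simp add: avg_def sum_divide_distrib[symmetric] sum_product)

lemma avg_Times: "avg A (\<lambda>a. avg B (f a)) = avg (A \<times> B) (\<lambda>(a, b). f a b)"
  by (simp add: avg_def sum_divide_distrib[symmetric] sum.cartesian_product card_cartesian_product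
      mult.commute)

lemma avg_reindex: "bij_betw h A B \<Longrightarrow> avg B f = avg A (\<lambda>x. f (h x))"
  by (simp add: avg_def bij_betw_same_card sum.reindex_bij_betw[symmetric])

lemma avg_PiE_prod:
  assumes "finite I" "finite N"
  shows "avg (I \<rightarrow>\<^sub>E N) (\<lambda>x. \<Prod>i\<in>I. f (x i)) = avg N f ^ card I"
  using assms prod_sum_PiE[of I "\<lambda>_. N" "\<lambda>_. f"]
  by (simp add: avg_def card_PiE power_divide)

lemma avg_PiE_insert:
  assumes "x \<notin> S"
  shows "avg (insert x S \<rightarrow>\<^sub>E N) f = avg (S \<rightarrow>\<^sub>E N) (\<lambda>\<psi>. avg N (\<lambda>a. f (\<psi>(x := a))))"
proof -
  have "bij_betw (\<lambda>(a, \<psi>). \<psi>(x := a)) (N \<times> (S \<rightarrow>\<^sub>E N)) (insert x S \<rightarrow>\<^sub>E N)"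
    using inj_combinator[OF assms, of "\<lambda>_. N"] by (simp add: bij_betw_def PiE_insert_eq)
  then show ?thesis
    by (subst avg_swap) (simp add: avg_reindex avg_Times case_prod_unfold)
qed

lemma avg_PiE_remove2:
  assumes "u \<noteq> v" "u \<in> V" "v \<in> V"
  shows "avg (V \<rightarrow>\<^sub>E N) f
    = avg (V - {u, v} \<rightarrow>\<^sub>E N) (\<lambda>\<psi>. avg N (\<lambda>a. avg N (\<lambda>b. f (\<psi>(u := a, v := b)))))"
proof -
  have "V = insert v (insert u (V - {u, v}))" using assms by blast
  then have "avg (V \<rightarrow>\<^sub>E N) f = avg (insert v (insert u (V - {u, v})) \<rightarrow>\<^sub>E N) f" by simp
  also have "\<dots> = avg (V - {u, v} \<rightarrow>\<^sub>E N) (\<lambda>\<psi>. avg N (\<lambda>a. avg N (\<lambda>b. f (\<psi>(u := a, v := b)))))"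
    using assms by (simp add: avg_PiE_insert)
  finally show ?thesis .
qed

lemma avg_PiE_singleton: "avg ({i} \<rightarrow>\<^sub>E N) (\<lambda>x. f (x i)) = avg N f"
  using avg_PiE_insert[of i "{}" N] by (simp add: avg_const)

lemma avg_PiE_doubleton:
  assumes "i \<noteq> j"
  shows "avg ({i, j} \<rightarrow>\<^sub>E N) (\<lambda>x. f (x i) (x j)) = avg N (\<lambda>a. avg N (f a))"
  using avg_PiE_remove2[of i j "{i, j}" N] assms by (simp add: avg_const)

lemma avg_square_ge: "(avg S f)\<^sup>2 \<le> avg S (\<lambda>x. (f x)\<^sup>2)"
proof (cases "card S = 0")
  case False
  then show ?thesis
    using sum_squared_le_sum_of_squares[of f S]
    by (simp add: avg_def power_divide power2_eq_square divide_simps mult.assoc)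
qed (simp add: avg_def)

lemma weighted_power_mean:
  fixes x s :: real
  assumes "0 \<le> x" "0 \<le> s"
  shows "real (k + l) * (x ^ k * s ^ l) \<le> real k * x ^ (k + l) + real l * s ^ (k + l)"
proof (cases "k = 0 \<or> l = 0")
  case False
  then have pos: "0 < k" "0 < l" by auto
  have powr_exponent: "(y ^ i) powr (real (k + l) / real i) = y ^ (k + l)" if "0 \<le> y" "0 < i"
    for y :: real and i
    using that pos by (cases "y = 0") (simp_all add: powr_realpow[symmetric] powr_powr power_0_left)
  have "x ^ k * s ^ l
      \<le> (x ^ k) powr (real (k + l) / real k) / (real (k + l) / real k)
        + (s ^ l) powr (real (k + l) / real l) / (real (k + l) / real l)"
    using pos assms
    by (intro Youngs_inequality) (simp_all add: pos_less_divide_eq add_divide_distrib[symmetric])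
  also have "\<dots> = (real k * x ^ (k + l) + real l * s ^ (k + l)) / real (k + l)"
    unfolding powr_exponent[OF assms(1) pos(1)] powr_exponent[OF assms(2) pos(2)]
    by (simp only: divide_divide_eq_right add_divide_distrib mult.commute)
  finally show ?thesis using pos by (simp add: pos_le_divide_eq mult.commute)
qed auto

lemma avg_power_mean:
  assumes nonneg: "\<And>x. x \<in> S \<Longrightarrow> 0 \<le> f x" and "k \<le> m"
  shows "avg S (\<lambda>x. f x ^ k) ^ m \<le> avg S (\<lambda>x. f x ^ m) ^ k"
proof (cases "k = 0 \<or> card S = 0")
  case True
  then show ?thesis using \<open>k \<le> m\<close> by (auto simp: avg_def power_0_left)
next
  case False
  then have S: "finite S" "S \<noteq> {}" and k: "0 < k" by (auto intro: card_ge_0_finite)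
  obtain l where m: "m = k + l" using \<open>k \<le> m\<close> by (rule le_Suc_ex[THEN exE])
  define s where "s = root k (avg S (\<lambda>x. f x ^ k))"
  have s: "0 \<le> s" "s ^ k = avg S (\<lambda>x. f x ^ k)"
    using nonneg k by (simp_all add: s_def avg_nonneg)
  have "avg S (\<lambda>x. (real m * s ^ l) * f x ^ k) \<le> avg S (\<lambda>x. real k * f x ^ m + real l * s ^ m)"
    using weighted_power_mean[OF nonneg s(1), of _ k l] by (intro avg_mono) (simp add: m mult_ac)
  then have "real m * s ^ l * s ^ k \<le> real k * avg S (\<lambda>x. f x ^ m) + real l * s ^ m"
    unfolding avg_cmult avg_add avg_const[OF S] s(2) .
  then have "real k * s ^ m \<le> real k * avg S (\<lambda>x. f x ^ m)"
    by (simp add: m power_add algebra_simps)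
  then have "(s ^ m) ^ k \<le> avg S (\<lambda>x. f x ^ m) ^ k"
    using k s(1) by (intro power_mono) auto
  then show ?thesis by (simp add: s(2)[symmetric] power_mult[symmetric] mult.commute)
qed

lemma avg_square_deviation:
  assumes "finite S" "S \<noteq> {}"
  shows "avg S (\<lambda>x. (f x - c)\<^sup>2) = avg S (\<lambda>x. (f x)\<^sup>2) - 2 * c * avg S f + c\<^sup>2"
proof -
  have "(\<lambda>x. (f x - c)\<^sup>2) = (\<lambda>x. (f x)\<^sup>2 - (2 * c) * f x + c\<^sup>2)"
    by (auto simp: power2_eq_square algebra_simps)
  then show ?thesis by (simp only: avg_add avg_diff avg_cmult avg_const[OF assms])
qed

lemma tendsto_avg_square_deviation:
  assumes "\<And>n. finite (S n)" "\<And>n. S n \<noteq> {}"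
    and "((\<lambda>n. avg (S n) (f n)) \<longlongrightarrow> c) F"
    and "((\<lambda>n. avg (S n) (\<lambda>x. (f n x)\<^sup>2)) \<longlongrightarrow> c\<^sup>2) F"
  shows "((\<lambda>n. avg (S n) (\<lambda>x. (f n x - c)\<^sup>2)) \<longlongrightarrow> 0) F"
proof -
  have "((\<lambda>n. avg (S n) (\<lambda>x. (f n x - c)\<^sup>2)) \<longlongrightarrow> c\<^sup>2 - 2 * c * c + c\<^sup>2) F"
    unfolding avg_square_deviation[OF assms(1,2)] by (intro tendsto_intros assms(3,4))
  then show ?thesis by (simp add: power2_eq_square)
qed

lemma tendsto_power_cancel:
  fixes f :: "'a \<Rightarrow> real"
  assumes "((\<lambda>x. f x ^ k) \<longlongrightarrow> c ^ k) F" "0 < k" "\<And>x. 0 \<le> f x" "0 \<le> c"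
  shows "(f \<longlongrightarrow> c) F"
  using tendsto_real_root[OF assms(1), of k] assms(2-4) by (simp add: real_root_power_cancel)

section \<open>Densities of complete bipartite graphs in a kernel\<close>

definition biclique_avg :: "nat \<Rightarrow> nat \<Rightarrow> 'a set \<Rightarrow> 'b set \<Rightarrow> ('a \<Rightarrow> 'b \<Rightarrow> real) \<Rightarrow> real" where
  "biclique_avg s t A B W =
     avg ({1..s} \<rightarrow>\<^sub>E A) (\<lambda>x. avg ({1..t} \<rightarrow>\<^sub>E B) (\<lambda>y. \<Prod>i\<in>{1..s}. \<Prod>j\<in>{1..t}. W (x i) (y j)))"

abbreviation four_cycle_avg :: "'a set \<Rightarrow> 'b set \<Rightarrow> ('a \<Rightarrow> 'b \<Rightarrow> real) \<Rightarrow> real" where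
  "four_cycle_avg \<equiv> biclique_avg 2 2"

definition degree :: "'a set \<Rightarrow> ('a \<Rightarrow> 'b \<Rightarrow> real) \<Rightarrow> 'b \<Rightarrow> real" where
  "degree A W b = avg A (\<lambda>a. W a b)"

definition codegree :: "'a set \<Rightarrow> ('a \<Rightarrow> 'b \<Rightarrow> real) \<Rightarrow> 'b \<Rightarrow> 'b \<Rightarrow> real" where
  "codegree A W b c = avg A (\<lambda>a. W a b * W a c)"

lemma biclique_avg_swap: "biclique_avg s t A B W = biclique_avg t s B A (\<lambda>b a. W a b)"
  unfolding biclique_avg_def by (subst avg_swap, subst prod.swap) (rule refl)

lemma biclique_avg_eq_avg_power:
  assumes "finite B"
  shows "biclique_avg s t A B W
    = avg ({1..s} \<rightarrow>\<^sub>E A) (\<lambda>x. avg B (\<lambda>b. \<Prod>i\<in>{1..s}. W (x i) b) ^ t)"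
  unfolding biclique_avg_def
  using avg_PiE_prod[of "{1..t}" B "\<lambda>b. \<Prod>i\<in>{1..s}. W (_ i) b"] assms
  by (subst prod.swap) simp

lemma biclique_avg_1_right:
  assumes "finite A"
  shows "biclique_avg s 1 A B W = avg B (\<lambda>b. degree A W b ^ s)"
  unfolding biclique_avg_swap[of s] biclique_avg_eq_avg_power[OF assms] degree_def
  using avg_PiE_singleton[of "1 :: nat" B "\<lambda>b. avg A (\<lambda>a. W a b) ^ s"] by simp

lemma biclique_avg_2_right:
  assumes "finite A"
  shows "biclique_avg s 2 A B W = avg B (\<lambda>b. avg B (\<lambda>c. codegree A W b c ^ s))"
proof -
  have "{1..2} = {1, 2 :: nat}" by auto
  then show ?thesis
    unfolding biclique_avg_swap[of s] biclique_avg_eq_avg_power[OF assms] codegree_def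
    using avg_PiE_doubleton[of 1 "2 :: nat" B "\<lambda>b c. avg A (\<lambda>a. W a b * W a c) ^ s"] by simp
qed

lemma four_cycle_avg_eq:
  "finite A \<Longrightarrow> four_cycle_avg A B W = avg B (\<lambda>b. avg B (\<lambda>c. (codegree A W b c)\<^sup>2))"
  by (rule biclique_avg_2_right)

lemma four_cycle_avg_nonneg: "finite A \<Longrightarrow> 0 \<le> four_cycle_avg A B W"
  by (simp add: four_cycle_avg_eq avg_nonneg)

lemma biclique_avg_nonneg:
  assumes "\<And>a b. a \<in> A \<Longrightarrow> b \<in> B \<Longrightarrow> 0 \<le> W a b"
  shows "0 \<le> biclique_avg s t A B W"
  unfolding biclique_avg_def
  by (intro avg_nonneg prod_nonneg ballI assms) (auto simp: PiE_iff)

lemma biclique_avg_power_mean_right: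
  assumes "finite B" and nonneg: "\<And>a b. a \<in> A \<Longrightarrow> b \<in> B \<Longrightarrow> 0 \<le> W a b" and "t \<le> t'"
  shows "biclique_avg s t A B W ^ t' \<le> biclique_avg s t' A B W ^ t"
  unfolding biclique_avg_eq_avg_power[OF assms(1)] using \<open>t \<le> t'\<close>
  by (intro avg_power_mean avg_nonneg prod_nonneg ballI nonneg) (auto simp: PiE_iff)

lemma biclique_avg_power_mean:
  assumes fin: "finite A" "finite B"
    and nonneg: "\<And>a b. a \<in> A \<Longrightarrow> b \<in> B \<Longrightarrow> 0 \<le> W a b"
    and le: "s \<le> s'" "t \<le> t'"
  shows "biclique_avg s t A B W ^ (s' * t') \<le> biclique_avg s' t' A B W ^ (s * t)"
proof -
  have "biclique_avg s t A B W ^ (s' * t') = (biclique_avg s t A B W ^ t') ^ s'"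
    by (simp add: power_mult[symmetric] mult.commute)
  also have "\<dots> \<le> (biclique_avg s t' A B W ^ t) ^ s'"
    using biclique_avg_power_mean_right[where s = s, OF fin(2) nonneg le(2)]
    by (intro power_mono) (simp_all add: biclique_avg_nonneg nonneg)
  also have "\<dots> = (biclique_avg t' s B A (\<lambda>b a. W a b) ^ s') ^ t"
    by (simp add: biclique_avg_swap[of s] power_mult[symmetric] mult.commute)
  also have "\<dots> \<le> (biclique_avg t' s' B A (\<lambda>b a. W a b) ^ s) ^ t"
    using biclique_avg_power_mean_right[where s = t' and A = B and W = "\<lambda>b a. W a b",
        OF fin(1) nonneg le(1)]
    by (intro power_mono) (simp_all add: biclique_avg_nonneg nonneg)
  also have "\<dots> = biclique_avg s' t' A B W ^ (s * t)"
    by (simp add: biclique_avg_swap[of s'] power_mult)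
  finally show ?thesis .
qed

lemma bilinear_avg_le_four_cycle_avg:
  assumes "finite A" and f_le_1: "\<And>a. a \<in> A \<Longrightarrow> \<bar>f a\<bar> \<le> 1" and g_le_1: "\<And>b. b \<in> B \<Longrightarrow> \<bar>g b\<bar> \<le> 1"
  shows "avg A (\<lambda>a. avg B (\<lambda>b. U a b * (f a * g b))) ^ 4 \<le> four_cycle_avg A B U"
proof -
  define h where "h a = avg B (\<lambda>b. g b * U a b)" for a
  have "(avg A (\<lambda>a. f a * h a))\<^sup>2 \<le> avg A (\<lambda>a. (f a * h a)\<^sup>2)"
    by (rule avg_square_ge)
  also have "\<dots> \<le> avg A (\<lambda>a. (h a)\<^sup>2)"
    using f_le_1
    by (intro avg_mono) (simp add: power_mult_distrib mult_left_le_one_le abs_square_le_1)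
  also have "\<dots> = avg A (\<lambda>a. avg (B \<times> B) (\<lambda>(b, c). (g b * g c) * (U a b * U a c)))"
    unfolding h_def power2_eq_square avg_mult avg_Times by (simp only: mult_ac)
  also have "\<dots> = avg (B \<times> B) (\<lambda>(b, c). (g b * g c) * codegree A U b c)"
    by (subst avg_swap) (simp only: case_prod_unfold avg_cmult codegree_def)
  finally have "((avg A (\<lambda>a. f a * h a))\<^sup>2)\<^sup>2
      \<le> (avg (B \<times> B) (\<lambda>(b, c). (g b * g c) * codegree A U b c))\<^sup>2"
    by (intro power_mono) auto
  also have "\<dots> \<le> avg (B \<times> B) (\<lambda>(b, c). ((g b * g c) * codegree A U b c)\<^sup>2)"
    using avg_square_ge by (simp add: case_prod_unfold)
  also have "\<dots> \<le> avg (B \<times> B) (\<lambda>(b, c). (codegree A U b c)\<^sup>2)"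
    using g_le_1
    by (intro avg_mono)
      (auto simp: power_mult_distrib mult_left_le_one_le abs_square_le_1 mult_le_one)
  also have "\<dots> = four_cycle_avg A B U" by (simp add: four_cycle_avg_eq[OF \<open>finite A\<close>] avg_Times)
  also have "avg A (\<lambda>a. f a * h a) = avg A (\<lambda>a. avg B (\<lambda>b. U a b * (f a * g b)))"
    unfolding h_def by (simp only: avg_cmult[symmetric] mult_ac)
  finally show ?thesis by simp
qed

lemma codegree_recentre:
  assumes "finite A" "A \<noteq> {}"
  shows "codegree A (\<lambda>a b. W a b - p) b c
    = (codegree A W b c - p\<^sup>2) - p * (degree A W b - p) - p * (degree A W c - p)"
proof -
  have "codegree A (\<lambda>a b. W a b - p) b c = avg A (\<lambda>a. W a b * W a c - p * W a b - p * W a c + p\<^sup>2)"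
    by (simp add: codegree_def algebra_simps power2_eq_square)
  also have "\<dots> = codegree A W b c - p * degree A W b - p * degree A W c + p\<^sup>2"
    unfolding avg_add avg_diff avg_cmult avg_const[OF assms] by (simp add: codegree_def degree_def)
  finally show ?thesis by (simp add: algebra_simps power2_eq_square)
qed

lemma four_cycle_avg_recentre_le:
  assumes A: "finite A" "A \<noteq> {}" and B: "finite B" "B \<noteq> {}"
  shows "four_cycle_avg A B (\<lambda>a b. W a b - p)
    \<le> 3 * (avg B (\<lambda>b. avg B (\<lambda>c. (codegree A W b c - p\<^sup>2)\<^sup>2))
      + 2 * p\<^sup>2 * avg B (\<lambda>b. (degree A W b - p)\<^sup>2))"
proof -
  have three_squares: "(x - y - z)\<^sup>2 \<le> 3 * (x\<^sup>2 + y\<^sup>2 + z\<^sup>2)" for x y z :: real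
  proof -
    have "3 * (x\<^sup>2 + y\<^sup>2 + z\<^sup>2) - (x - y - z)\<^sup>2 = (x + y)\<^sup>2 + (x + z)\<^sup>2 + (y - z)\<^sup>2"
      by (simp add: power2_eq_square algebra_simps)
    then show ?thesis by (smt (verit) zero_le_power2)
  qed
  have "four_cycle_avg A B (\<lambda>a b. W a b - p) \<le> avg B (\<lambda>b. avg B (\<lambda>c.
      3 * ((codegree A W b c - p\<^sup>2)\<^sup>2 + (p * (degree A W b - p))\<^sup>2 + (p * (degree A W c - p))\<^sup>2)))"
    unfolding four_cycle_avg_eq[OF A(1)] codegree_recentre[OF A]
    by (intro avg_mono three_squares)
  also have "\<dots> = 3 * (avg B (\<lambda>b. avg B (\<lambda>c. (codegree A W b c - p\<^sup>2)\<^sup>2))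
      + 2 * p\<^sup>2 * avg B (\<lambda>b. (degree A W b - p)\<^sup>2))"
    unfolding power_mult_distrib avg_cmult avg_add avg_const[OF B] by simp
  finally show ?thesis .
qed

lemma tendsto_biclique_avg:
  assumes fin: "\<And>n. finite (A n)" "\<And>n. finite (B n)"
    and nonneg: "\<And>n a b. a \<in> A n \<Longrightarrow> b \<in> B n \<Longrightarrow> 0 \<le> W n a b" and "0 \<le> p"
    and edge: "((\<lambda>n. biclique_avg 1 1 (A n) (B n) (W n)) \<longlongrightarrow> p) F"
    and four_cycle: "((\<lambda>n. four_cycle_avg (A n) (B n) (W n)) \<longlongrightarrow> p ^ 4) F"
    and st: "s \<in> {1..2}" "t \<in> {1..2}"
  shows "((\<lambda>n. biclique_avg s t (A n) (B n) (W n)) \<longlongrightarrow> p ^ (s * t)) F"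
proof (rule tendsto_power_cancel[where k = 4])
  let ?d = "\<lambda>s t n. biclique_avg s t (A n) (B n) (W n)"
  have d_nonneg: "0 \<le> ?d s t n" for s t n using nonneg by (rule biclique_avg_nonneg)
  show "((\<lambda>n. ?d s t n ^ 4) \<longlongrightarrow> (p ^ (s * t)) ^ 4) F"
  proof (rule tendsto_sandwich)
    have "?d 1 1 n ^ (s * t) \<le> ?d s t n" for n
      using biclique_avg_power_mean[where s = 1 and s' = s and t = 1 and t' = t, OF fin nonneg] st
      by simp
    then show "\<forall>\<^sub>F n in F. (?d 1 1 n ^ (s * t)) ^ 4 \<le> ?d s t n ^ 4"
      using d_nonneg by (intro always_eventually allI power_mono) auto
    show "\<forall>\<^sub>F n in F. ?d s t n ^ 4 \<le> ?d 2 2 n ^ (s * t)"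
      using biclique_avg_power_mean[where s = s and s' = 2 and t = t and t' = 2, OF fin nonneg] st
      by simp
    show "((\<lambda>n. (?d 1 1 n ^ (s * t)) ^ 4) \<longlongrightarrow> (p ^ (s * t)) ^ 4) F"
      by (intro tendsto_power edge)
    have "(p ^ (s * t)) ^ 4 = (p ^ 4) ^ (s * t)" by (simp add: power_mult[symmetric] mult.commute)
    then show "((\<lambda>n. ?d 2 2 n ^ (s * t)) \<longlongrightarrow> (p ^ (s * t)) ^ 4) F"
      using tendsto_power[OF four_cycle] by simp
  qed
qed (use \<open>0 \<le> p\<close> nonneg in \<open>simp_all add: biclique_avg_nonneg\<close>)

lemma tendsto_four_cycle_avg_recentred:
  assumes A: "\<And>n. finite (A n)" "\<And>n. A n \<noteq> {}" and B: "\<And>n. finite (B n)" "\<And>n. B n \<noteq> {}"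
    and nonneg: "\<And>n a b. a \<in> A n \<Longrightarrow> b \<in> B n \<Longrightarrow> 0 \<le> W n a b" and p: "0 \<le> p"
    and edge: "((\<lambda>n. biclique_avg 1 1 (A n) (B n) (W n)) \<longlongrightarrow> p) F"
    and four_cycle: "((\<lambda>n. four_cycle_avg (A n) (B n) (W n)) \<longlongrightarrow> p ^ 4) F"
  shows "((\<lambda>n. four_cycle_avg (A n) (B n) (\<lambda>a b. W n a b - p)) \<longlongrightarrow> 0) F"
proof (rule tendsto_sandwich[OF _ _ tendsto_const])
  let ?deg = "\<lambda>n. avg (B n) (\<lambda>b. (degree (A n) (W n) b - p)\<^sup>2)"
  let ?codeg = "\<lambda>n. avg (B n) (\<lambda>b. avg (B n) (\<lambda>c. (codegree (A n) (W n) b c - p\<^sup>2)\<^sup>2))"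
  note biclique =
    tendsto_biclique_avg[where A = A and B = B and W = W, OF A(1) B(1) nonneg p edge four_cycle]
  have deg: "(?deg \<longlongrightarrow> 0) F"
    using biclique[of 1 1] biclique[of 2 1]
    by (intro tendsto_avg_square_deviation B)
      (simp_all add: biclique_avg_1_right[OF A(1)] del: One_nat_def)
  have "((\<lambda>n. avg (B n \<times> B n) (\<lambda>(b, c). codegree (A n) (W n) b c)) \<longlongrightarrow> p\<^sup>2) F"
    using biclique[of 1 2] by (simp add: biclique_avg_2_right[OF A(1)] avg_Times)
  moreover have
    "((\<lambda>n. avg (B n \<times> B n) (\<lambda>x. (case x of (b, c) \<Rightarrow> codegree (A n) (W n) b c)\<^sup>2)) \<longlongrightarrow> (p\<^sup>2)\<^sup>2) F"
    using four_cycle by (simp add: four_cycle_avg_eq A avg_Times case_prod_unfold)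
  ultimately have codeg: "(?codeg \<longlongrightarrow> 0) F"
    using tendsto_avg_square_deviation[of "\<lambda>n. B n \<times> B n"] B
    by (simp add: avg_Times case_prod_unfold)
  show "\<forall>\<^sub>F n in F. 0 \<le> four_cycle_avg (A n) (B n) (\<lambda>a b. W n a b - p)"
    by (simp add: four_cycle_avg_nonneg A)
  show "\<forall>\<^sub>F n in F. four_cycle_avg (A n) (B n) (\<lambda>a b. W n a b - p)
      \<le> 3 * (?codeg n + 2 * p\<^sup>2 * ?deg n)"
    by (intro always_eventually allI four_cycle_avg_recentre_le A B)
  have "((\<lambda>n. 3 * (?codeg n + 2 * p\<^sup>2 * ?deg n)) \<longlongrightarrow> 3 * (0 + 2 * p\<^sup>2 * 0)) F"
    by (intro tendsto_intros deg codeg)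
  then show "((\<lambda>n. 3 * (?codeg n + 2 * p\<^sup>2 * ?deg n)) \<longlongrightarrow> 0) F" by simp
qed

section \<open>Four-cycles control all homomorphism densities\<close>

definition weighted_hom_density :: "'a set \<Rightarrow> 'a set set \<Rightarrow> 'b set \<Rightarrow> ('b set \<Rightarrow> real) \<Rightarrow> real" where
  "weighted_hom_density V E N w = avg (V \<rightarrow>\<^sub>E N) (\<lambda>\<phi>. \<Prod>e\<in>E. w (\<phi> ` e))"

lemma weighted_hom_density_const:
  assumes "finite V" "finite N" "N \<noteq> {}"
  shows "weighted_hom_density V E N (\<lambda>_. c) = c ^ card E"
  using assms
  by (simp add: weighted_hom_density_def avg_const finite_PiE PiE_eq_empty_iff)

text \<open>
  Since \<open>{u, v} \<notin> E\<close>, each factor depends on the image of at most one of \<open>u\<close> and \<open>v\<close>. This is what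
  makes the edge \<open>{u, v}\<close> accessible to Cauchy-Schwarz once the other vertices are fixed.
\<close>

lemma prod_image_fun_upd2:
  fixes w :: "'b set \<Rightarrow> 'c :: comm_monoid_mult"
  assumes E: "finite E" "\<And>e. e \<in> E \<Longrightarrow> card e = 2" "{u, v} \<notin> E" and uv: "u \<noteq> v"
  shows "(\<Prod>e\<in>E. w ((\<psi>(u := a, v := b)) ` e))
    = (\<Prod>e\<in>{e \<in> E. v \<notin> e}. w (\<psi>(u := a) ` e)) * (\<Prod>e\<in>{e \<in> E. v \<in> e}. w (\<psi>(v := b) ` e))"
proof -
  have avoids_v: "(\<psi>(u := a, v := b)) ` e = \<psi>(u := a) ` e" if "v \<notin> e" for e
    using that by (intro image_cong) auto
  have contains_v: "(\<psi>(u := a, v := b)) ` e = \<psi>(v := b) ` e" if "e \<in> E" "v \<in> e" for e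
  proof -
    have "u \<notin> e" using that E(2)[OF that(1)] E(3) uv by (auto simp: card_2_iff insert_commute)
    then show ?thesis by (intro image_cong) auto
  qed
  have "E = {e \<in> E. v \<notin> e} \<union> {e \<in> E. v \<in> e}" by blast
  then have "(\<Prod>e\<in>E. w ((\<psi>(u := a, v := b)) ` e))
      = (\<Prod>e\<in>{e \<in> E. v \<notin> e} \<union> {e \<in> E. v \<in> e}. w ((\<psi>(u := a, v := b)) ` e))" by simp
  also have "\<dots> = (\<Prod>e\<in>{e \<in> E. v \<notin> e}. w ((\<psi>(u := a, v := b)) ` e))
      * (\<Prod>e\<in>{e \<in> E. v \<in> e}. w ((\<psi>(u := a, v := b)) ` e))"
    using E(1) by (intro prod.union_disjoint) auto
  also have "\<dots> = (\<Prod>e\<in>{e \<in> E. v \<notin> e}. w (\<psi>(u := a) ` e)) * (\<Prod>e\<in>{e \<in> E. v \<in> e}. w (\<psi>(v := b) ` e))"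
    by (intro arg_cong2[of _ _ _ _ "(*)"] prod.cong refl)
      (metis (lifting) mem_Collect_eq avoids_v, metis (lifting) mem_Collect_eq contains_v)
  finally show ?thesis .
qed

lemma weighted_hom_density_insert_edge:
  assumes V: "finite V" and N: "finite N" "N \<noteq> {}"
    and uv: "u \<noteq> v" "u \<in> V" "v \<in> V"
    and E: "finite E" "\<And>e. e \<in> E \<Longrightarrow> card e = 2" "{u, v} \<notin> E" and w: "\<And>e. \<bar>w e\<bar> \<le> 1"
  shows "\<bar>weighted_hom_density V (insert {u, v} E) N w - p * weighted_hom_density V E N w\<bar>
    \<le> root 4 (four_cycle_avg N N (\<lambda>a b. w {a, b} - p))"
proof -
  let ?U = "\<lambda>a b. w {a, b} - p"
  let ?f = "\<lambda>\<psi> a. \<Prod>e\<in>{e \<in> E. v \<notin> e}. w (\<psi>(u := a) ` e)"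
  let ?g = "\<lambda>\<psi> b. \<Prod>e\<in>{e \<in> E. v \<in> e}. w (\<psi>(v := b) ` e)"
  let ?L = "\<lambda>\<psi>. avg N (\<lambda>a. avg N (\<lambda>b. ?U a b * (?f \<psi> a * ?g \<psi> b)))"
  have prod_le_1: "\<bar>\<Prod>e\<in>E'. w (f e)\<bar> \<le> 1" for E' :: "'a set set" and f
    using w unfolding abs_prod by (intro prod_le_1) auto
  have L_le: "\<bar>?L \<psi>\<bar> \<le> root 4 (four_cycle_avg N N ?U)" for \<psi>
  proof -
    have "root 4 (\<bar>?L \<psi>\<bar> ^ 4) \<le> root 4 (four_cycle_avg N N ?U)"
      using bilinear_avg_le_four_cycle_avg[OF N(1) prod_le_1 prod_le_1]
      by (intro real_root_le_mono) auto
    moreover have "root 4 (\<bar>?L \<psi>\<bar> ^ 4) = \<bar>?L \<psi>\<bar>" by (rule real_root_power_cancel) auto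
    ultimately show ?thesis by (simp only:)
  qed
  have fibres: "finite (V - {u, v} \<rightarrow>\<^sub>E N)" "(V - {u, v} \<rightarrow>\<^sub>E N) \<noteq> {}"
    using V N by (auto simp: finite_PiE PiE_eq_empty_iff)
  have "weighted_hom_density V (insert {u, v} E) N w - p * weighted_hom_density V E N w
      = avg (V \<rightarrow>\<^sub>E N) (\<lambda>\<phi>. ?U (\<phi> u) (\<phi> v) * (\<Prod>e\<in>E. w (\<phi> ` e)))"
    unfolding weighted_hom_density_def avg_cmult[symmetric] avg_diff[symmetric]
    using E by (simp add: left_diff_distrib)
  also have "\<dots> = avg (V - {u, v} \<rightarrow>\<^sub>E N) ?L"
    unfolding avg_PiE_remove2[OF uv]
    by (simp only: prod_image_fun_upd2[where w = w, OF E uv(1)] fun_upd_same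
        fun_upd_other[OF uv(1)])
  finally show ?thesis using avg_abs_le[OF fibres L_le] by simp
qed

lemma weighted_counting_lemma:
  assumes V: "finite V" and N: "finite N" "N \<noteq> {}" and "finite E"
    and E: "\<And>e. e \<in> E \<Longrightarrow> e \<subseteq> V \<and> card e = 2"
    and w: "\<And>e. \<bar>w e\<bar> \<le> 1" and p: "\<bar>p\<bar> \<le> 1"
  shows "\<bar>weighted_hom_density V E N w - p ^ card E\<bar>
    \<le> real (card E) * root 4 (four_cycle_avg N N (\<lambda>a b. w {a, b} - p))"
  using \<open>finite E\<close> E
proof (induction E rule: finite_induct)
  case empty
  show ?case
    using V N by (simp add: weighted_hom_density_def avg_const finite_PiE PiE_eq_empty_iff)
next
  case (insert e E)
  let ?t = "\<lambda>E. weighted_hom_density V E N w"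
  let ?r = "root 4 (four_cycle_avg N N (\<lambda>a b. w {a, b} - p))"
  obtain u v where e: "e = {u, v}" "u \<noteq> v" "u \<in> V" "v \<in> V"
    using insert.prems[of e] by (auto simp: card_2_iff)
  have "\<bar>?t (insert e E) - p * ?t E\<bar> \<le> ?r"
    using insert unfolding e(1) by (intro weighted_hom_density_insert_edge V N e(2-4) w) auto
  moreover have "\<bar>p * ?t E - p * p ^ card E\<bar> \<le> real (card E) * ?r"
  proof -
    have "\<bar>p * ?t E - p * p ^ card E\<bar> = \<bar>p\<bar> * \<bar>?t E - p ^ card E\<bar>"
      by (simp add: right_diff_distrib[symmetric] abs_mult)
    also have "\<dots> \<le> \<bar>?t E - p ^ card E\<bar>" using p by (simp add: mult_left_le_one_le)
    also have "\<dots> \<le> real (card E) * ?r" using insert by simp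
    finally show ?thesis .
  qed
  ultimately show ?case using insert.hyps by (simp add: algebra_simps)
qed

section \<open>Homomorphism densities of graphs\<close>

lemma edgeE:
  assumes "finite_simple_graph G" "e \<in> edges G"
  obtains u v where "e = {u, v}" "u \<noteq> v" "u \<in> verts G" "v \<in> verts G"
proof -
  have "e \<subseteq> verts G" "card e = 2" using assms unfolding finite_simple_graph_def by blast+
  then show thesis using that by (auto simp: card_2_iff)
qed

lemma finite_edges: "finite_simple_graph G \<Longrightarrow> finite (edges G)"
  by (rule finite_subset[of _ "Pow (verts G)"]) (auto simp: finite_simple_graph_def)

lemma prod_indicator:
  "finite S \<Longrightarrow> (\<Prod>x\<in>S. indicat_real A (f x)) = of_bool (\<forall>x\<in>S. f x \<in> A)"
  by (induction S rule: finite_induct) (auto simp: indicator_def)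

lemma graph_homs_eq:
  assumes "finite_simple_graph G"
  shows "graph_homs G H = {\<phi> \<in> verts G \<rightarrow>\<^sub>E verts H. \<forall>e\<in>edges G. \<phi> ` e \<in> edges H}"
proof -
  have "(\<forall>u v. {u, v} \<in> edges G \<longrightarrow> {\<phi> u, \<phi> v} \<in> edges H) \<longleftrightarrow> (\<forall>e\<in>edges G. \<phi> ` e \<in> edges H)"
    (is "?pairs \<longleftrightarrow> ?sets") for \<phi>
  proof
    assume pairs: ?pairs
    show ?sets
    proof
      fix e assume "e \<in> edges G"
      moreover from this obtain u v where "e = {u, v}" using edgeE[OF assms] by metis
      ultimately show "\<phi> ` e \<in> edges H" using pairs by simp
    qed
  qed (auto dest: bspec)
  then show ?thesis by (simp add: graph_homs_def)
qed

lemma hom_density_eq_weighted_hom_density: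
  assumes G: "finite_simple_graph G" and H: "finite_simple_graph H"
  shows "hom_density G H
    = weighted_hom_density (verts G) (edges G) (verts H) (indicat_real (edges H))"
proof -
  have "finite (verts G \<rightarrow>\<^sub>E verts H)"
    using G H by (simp add: finite_simple_graph_def finite_PiE)
  then show ?thesis
    by (simp add: hom_density_def graph_homs_eq[OF G] weighted_hom_density_def avg_def
        prod_indicator finite_edges[OF G] Int_def)
qed

definition biclique_density :: "nat \<Rightarrow> nat \<Rightarrow> 'a sgraph \<Rightarrow> real" where
  "biclique_density s t H =
     biclique_avg s t (verts H) (verts H) (\<lambda>a b. indicat_real (edges H) {a, b})"

lemma biclique_density_nonneg: "0 \<le> biclique_density s t H"
  by (simp add: biclique_density_def biclique_avg_nonneg)

lemma biclique_density_power_mean: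
  assumes "finite_simple_graph H" "s \<le> s'" "t \<le> t'"
  shows "biclique_density s t H ^ (s' * t') \<le> biclique_density s' t' H ^ (s * t)"
  unfolding biclique_density_def using assms
  by (intro biclique_avg_power_mean) (auto simp: finite_simple_graph_def)

lemma hom_density_K2_eq_avg:
  assumes "finite_simple_graph H"
  shows "hom_density K2 H
    = avg (verts H) (\<lambda>a. avg (verts H) (\<lambda>b. indicat_real (edges H) {a, b}))"
  unfolding hom_density_eq_weighted_hom_density[OF finite_simple_graph_K2 assms]
  using avg_PiE_doubleton[of 0 "1 :: nat" "verts H" "\<lambda>a b. indicat_real (edges H) {a, b}"]
  by (simp add: weighted_hom_density_def K2_def)

lemma hom_density_K2_eq_biclique_density:
  assumes "finite_simple_graph H"
  shows "hom_density K2 H = biclique_density 1 1 H"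
  unfolding hom_density_K2_eq_avg[OF assms] biclique_density_def
  using assms
  by (subst avg_swap)
    (simp add: biclique_avg_1_right degree_def finite_simple_graph_def del: One_nat_def)

lemma edges_empty_if_hom_density_K2_eq_0:
  assumes H: "finite_simple_graph H" and "hom_density K2 H = 0"
  shows "edges H = {}"
proof (rule ccontr)
  assume "edges H \<noteq> {}"
  then obtain e where "e \<in> edges H" by blast
  then obtain u v where uv: "{u, v} \<in> edges H" "u \<in> verts H" "v \<in> verts H"
    using edgeE[OF H] by metis
  have "finite (verts K2 \<rightarrow>\<^sub>E verts H)"
    using H by (simp add: K2_def finite_simple_graph_def finite_PiE)
  moreover have "graph_homs K2 H \<subseteq> verts K2 \<rightarrow>\<^sub>E verts H" by (auto simp: graph_homs_def)
  moreover have "(\<lambda>i\<in>{0, 1}. if i = 0 then u else v) \<in> graph_homs K2 H"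
    unfolding graph_homs_eq[OF finite_simple_graph_K2] using uv by (auto simp: K2_def)
  ultimately have "0 < card (graph_homs K2 H)" "0 < card (verts K2 \<rightarrow>\<^sub>E verts H)"
    by (auto simp: card_gt_0_iff intro: finite_subset)
  then show False using assms(2) by (simp add: hom_density_def)
qed

section \<open>Forcing graphs\<close>

lemma quasi_random_if_four_cycle:
  fixes H :: "nat \<Rightarrow> 'b sgraph"
  assumes H: "increasing_graph_seq H" and p: "0 < p" "p \<le> 1"
    and edge: "(\<lambda>n. biclique_density 1 1 (H n)) \<longlonglongrightarrow> p"
    and four_cycle: "(\<lambda>n. biclique_density 2 2 (H n)) \<longlonglongrightarrow> p ^ 4"
  shows "quasi_random p H"
proof -
  define U where
    "U n = four_cycle_avg (verts (H n)) (verts (H n)) (\<lambda>a b. indicat_real (edges (H n)) {a, b} - p)"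
    for n
  have Hn: "finite_simple_graph (H n)" "finite (verts (H n))" "verts (H n) \<noteq> {}" for n
    using H by (simp_all add: increasing_graph_seq_def finite_simple_graph_def)
  have "U \<longlonglongrightarrow> 0"
    unfolding U_def using edge four_cycle p
    by (intro tendsto_four_cycle_avg_recentred Hn) (simp_all add: biclique_density_def)
  then have U: "(\<lambda>n. root 4 (U n)) \<longlonglongrightarrow> 0" using tendsto_real_root[of U 0 _ 4] by simp
  have "(\<lambda>n. hom_density J (H n)) \<longlonglongrightarrow> p ^ card (edges J)" if J: "finite_simple_graph J"
    for J :: "nat sgraph"
  proof (rule LIM_zero_cancel, rule tendsto_0_le[OF U])
    have "\<bar>hom_density J (H n) - p ^ card (edges J)\<bar> \<le> real (card (edges J)) * root 4 (U n)" for n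
      unfolding hom_density_eq_weighted_hom_density[OF J Hn(1)] U_def
      using J p finite_edges[OF J]
      by (intro weighted_counting_lemma Hn) (auto simp: finite_simple_graph_def)
    then show "\<forall>\<^sub>F n in sequentially. norm (hom_density J (H n) - p ^ card (edges J))
        \<le> norm (root 4 (U n)) * real (card (edges J))"
      by (simp add: U_def four_cycle_avg_nonneg Hn mult.commute)
  qed
  then show ?thesis
    using H p by (auto simp: quasi_random_def intro!: tendsto_imp_asymp_equiv_const)
qed

lemma quasi_random_0_if_edgeless:
  fixes H :: "nat \<Rightarrow> 'b sgraph"
  assumes H: "increasing_graph_seq H" and edgeless: "\<forall>\<^sub>F n in sequentially. edges (H n) = {}"
  shows "quasi_random 0 H"
proof -
  have "hom_density J (H n) = 0 ^ card (edges J)"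
    if J: "finite_simple_graph J" and "edges (H n) = {}" for J :: "nat sgraph" and n
  proof -
    have Hn: "finite_simple_graph (H n)" "verts (H n) \<noteq> {}"
      using H by (simp_all add: increasing_graph_seq_def)
    have "indicat_real (edges (H n)) = (\<lambda>_. 0)" using that by auto
    then show ?thesis
      using J Hn
      by (simp add: hom_density_eq_weighted_hom_density weighted_hom_density_const
          finite_simple_graph_def)
  qed
  then show ?thesis
    using H edgeless
    by (auto simp: quasi_random_def intro!: asymp_equiv_refl_ev elim!: eventually_mono)
qed

lemma tendsto_four_cycle_density:
  fixes H :: "nat \<Rightarrow> 'b sgraph"
  assumes G: "finite_simple_graph G" "edges G \<noteq> {}" and H: "\<And>n. finite_simple_graph (H n)"
    and "0 \<le> p"
    and edge: "(\<lambda>n. biclique_density 1 1 (H n)) \<longlonglongrightarrow> p"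
    and G_density: "(\<lambda>n. hom_density G (H n)) \<longlonglongrightarrow> p ^ card (edges G)"
    and four_cycle_le: "\<And>n. biclique_density 2 2 (H n) ^ card (edges G) \<le> hom_density G (H n) ^ 4"
  shows "(\<lambda>n. biclique_density 2 2 (H n)) \<longlonglongrightarrow> p ^ 4"
proof (rule tendsto_power_cancel)
  let ?e = "card (edges G)"
  show "(\<lambda>n. biclique_density 2 2 (H n) ^ ?e) \<longlonglongrightarrow> (p ^ 4) ^ ?e"
  proof (rule tendsto_sandwich)
    have "biclique_density 1 1 (H n) ^ 4 \<le> biclique_density 2 2 (H n)" for n
      using biclique_density_power_mean[OF H, of 1 2 1 2] by simp
    then show "\<forall>\<^sub>F n in sequentially.
        (biclique_density 1 1 (H n) ^ 4) ^ ?e \<le> biclique_density 2 2 (H n) ^ ?e"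
      by (intro always_eventually allI power_mono) simp_all
    show "\<forall>\<^sub>F n in sequentially. biclique_density 2 2 (H n) ^ ?e \<le> hom_density G (H n) ^ 4"
      using four_cycle_le by simp
    show "(\<lambda>n. (biclique_density 1 1 (H n) ^ 4) ^ ?e) \<longlonglongrightarrow> (p ^ 4) ^ ?e"
      by (intro tendsto_power edge)
    have "(p ^ 4) ^ ?e = (p ^ ?e) ^ 4" by (simp add: power_mult[symmetric] mult.commute)
    then show "(\<lambda>n. hom_density G (H n) ^ 4) \<longlonglongrightarrow> (p ^ 4) ^ ?e"
      using tendsto_power[OF G_density] by simp
  qed
qed (use G \<open>0 \<le> p\<close> in \<open>simp_all add: biclique_density_nonneg card_gt_0_iff finite_edges\<close>)

lemma forcing_if_ge_four_cycle:
  assumes G: "finite_simple_graph G" "edges G \<noteq> {}"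
    and four_cycle_le: "\<And>H :: nat sgraph. finite_simple_graph H \<Longrightarrow> verts H \<noteq> {} \<Longrightarrow>
      biclique_density 2 2 H ^ card (edges G) \<le> hom_density G H ^ 4"
  shows "forcing G"
  unfolding forcing_def
proof (intro ballI allI impI, elim conjE)
  fix p :: real and H :: "nat \<Rightarrow> nat sgraph"
  assume p: "p \<in> {0..1}" and H: "increasing_graph_seq H"
    and K2_asymp: "(\<lambda>n. hom_density K2 (H n)) \<sim>[sequentially] (\<lambda>n. p)"
    and G_asymp: "(\<lambda>n. hom_density G (H n)) \<sim>[sequentially] (\<lambda>n. p ^ card (edges G))"
  have Hn: "finite_simple_graph (H n)" "verts (H n) \<noteq> {}" for n
    using H by (simp_all add: increasing_graph_seq_def)
  show "quasi_random p H"
  proof (cases "p = 0")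
    case True
    then have "\<forall>\<^sub>F n in sequentially. hom_density K2 (H n) = 0"
      using K2_asymp by (simp add: asymp_equiv_0_right_iff)
    then show ?thesis
      using True edges_empty_if_hom_density_K2_eq_0[OF Hn(1)]
      by (auto intro!: quasi_random_0_if_edgeless H elim!: eventually_mono)
  next
    case False
    have edge: "(\<lambda>n. biclique_density 1 1 (H n)) \<longlonglongrightarrow> p"
      using asymp_equivD_const[OF K2_asymp] by (simp add: hom_density_K2_eq_biclique_density Hn)
    moreover have "(\<lambda>n. biclique_density 2 2 (H n)) \<longlonglongrightarrow> p ^ 4"
      using p asymp_equivD_const[OF G_asymp]
      by (intro tendsto_four_cycle_density[OF G] Hn edge four_cycle_le) auto
    ultimately show ?thesis using p False by (intro quasi_random_if_four_cycle H) auto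
  qed
qed

section \<open>Blow-ups\<close>

lemma edge_blow_up_iff:
  "{(v, i), (w, j)} \<in> edges (blow_up m G) \<longleftrightarrow> {v, w} \<in> edges G \<and> i \<in> {1..m} \<and> j \<in> {1..m}"
  unfolding blow_up_def by (auto simp: doubleton_eq_iff insert_commute)

lemma card_edges_blow_up_over_edge:
  assumes "v \<noteq> w" "{v, w} \<in> edges G"
  shows "card {x \<in> edges (blow_up m G). fst ` x = {v, w}} = m * m"
proof -
  let ?edge = "\<lambda>(i, j). {(v, i), (w, j)}"
  have "{x \<in> edges (blow_up m G). fst ` x = {v, w}} = ?edge ` ({1..m} \<times> {1..m})"
  proof (intro equalityI subsetI)
    fix x assume "x \<in> {x \<in> edges (blow_up m G). fst ` x = {v, w}}"
    then obtain v' i w' j where x: "x = {(v', i), (w', j)}" "{v', w'} = {v, w}"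
      and ij: "i \<in> {1..m}" "j \<in> {1..m}"
      by (auto simp: blow_up_def)
    then have "x = ?edge (i, j) \<or> x = ?edge (j, i)" by (auto simp: doubleton_eq_iff)
    then show "x \<in> ?edge ` ({1..m} \<times> {1..m})" using ij by blast
  qed (use assms in \<open>auto simp: edge_blow_up_iff\<close>)
  moreover have "inj_on ?edge ({1..m} \<times> {1..m})"
    using assms(1) by (auto simp: inj_on_def doubleton_eq_iff)
  ultimately show ?thesis by (simp add: card_image card_cartesian_product)
qed

lemma card_edges_blow_up:
  assumes G: "finite_simple_graph G"
  shows "card (edges (blow_up m G)) = m * m * card (edges G)"
proof -
  have "(`) fst ` edges (blow_up m G) \<subseteq> edges G" by (auto simp: blow_up_def)
  then have "card (edges (blow_up m G)) = (\<Sum>e\<in>edges G. card {x \<in> edges (blow_up m G). fst ` x = e})"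
    using sum.group[of "edges (blow_up m G)" "edges G" "(`) fst" "\<lambda>_. 1 :: nat"]
      finite_edges[OF G] finite_edges[OF finite_simple_graph_blow_up[OF G]]
    by simp
  also have "\<dots> = (\<Sum>e\<in>edges G. m * m)"
  proof (intro sum.cong refl)
    fix e assume "e \<in> edges G"
    moreover from this obtain v w where "e = {v, w}" "v \<noteq> w" using edgeE[OF G] by metis
    ultimately show "card {x \<in> edges (blow_up m G). fst ` x = e} = m * m"
      by (simp add: card_edges_blow_up_over_edge)
  qed
  finally show ?thesis by simp
qed

definition tuple_graph :: "nat \<Rightarrow> 'b sgraph \<Rightarrow> (nat \<Rightarrow> 'b) sgraph" where
  "tuple_graph m H =
     \<lparr>verts = {1..m} \<rightarrow>\<^sub>E verts H,
      edges = {{x, y} | x y. x \<in> {1..m} \<rightarrow>\<^sub>E verts H \<and> y \<in> {1..m} \<rightarrow>\<^sub>E verts H \<and>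
        (\<forall>i\<in>{1..m}. \<forall>j\<in>{1..m}. {x i, y j} \<in> edges H)}\<rparr>"

lemma verts_tuple_graph: "verts (tuple_graph m H) = {1..m} \<rightarrow>\<^sub>E verts H"
  by (simp add: tuple_graph_def)

lemma edge_tuple_graph_iff:
  assumes "x \<in> {1..m} \<rightarrow>\<^sub>E verts H" "y \<in> {1..m} \<rightarrow>\<^sub>E verts H"
  shows "{x, y} \<in> edges (tuple_graph m H) \<longleftrightarrow> (\<forall>i\<in>{1..m}. \<forall>j\<in>{1..m}. {x i, y j} \<in> edges H)"
proof
  assume "{x, y} \<in> edges (tuple_graph m H)"
  then obtain x' y' where "{x, y} = {x', y'}"
    and adjacent: "\<forall>i\<in>{1..m}. \<forall>j\<in>{1..m}. {x' i, y' j} \<in> edges H"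
    by (auto simp: tuple_graph_def)
  then have "x = x' \<and> y = y' \<or> x = y' \<and> y = x'" by (simp add: doubleton_eq_iff)
  then show "\<forall>i\<in>{1..m}. \<forall>j\<in>{1..m}. {x i, y j} \<in> edges H"
    using adjacent by (auto simp: insert_commute)
next
  assume "\<forall>i\<in>{1..m}. \<forall>j\<in>{1..m}. {x i, y j} \<in> edges H"
  then show "{x, y} \<in> edges (tuple_graph m H)" using assms by (auto simp: tuple_graph_def)
qed

lemma finite_simple_graph_tuple_graph:
  assumes H: "finite_simple_graph H" and m: "m \<ge> 1"
  shows "finite_simple_graph (tuple_graph m H)"
proof -
  have "{a, a} \<notin> edges H" for a using H by (auto simp: finite_simple_graph_def)
  then have "x \<noteq> y" if "\<forall>i\<in>{1..m}. \<forall>j\<in>{1..m}. {x i, y j} \<in> edges H" for x y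
    using that m by (metis atLeastAtMost_iff order_refl)
  then show ?thesis
    using H by (auto simp: finite_simple_graph_def tuple_graph_def finite_PiE)
qed

lemma hom_density_K2_tuple_graph:
  assumes "finite_simple_graph H" "m \<ge> 1"
  shows "hom_density K2 (tuple_graph m H) = biclique_density m m H"
  unfolding hom_density_K2_eq_avg[OF finite_simple_graph_tuple_graph[OF assms]]
    biclique_density_def biclique_avg_def verts_tuple_graph
proof (intro avg_cong refl)
  fix x y assume "x \<in> {1..m} \<rightarrow>\<^sub>E verts H" "y \<in> {1..m} \<rightarrow>\<^sub>E verts H"
  then show "indicat_real (edges (tuple_graph m H)) {x, y}
      = (\<Prod>i\<in>{1..m}. \<Prod>j\<in>{1..m}. indicat_real (edges H) {x i, y j})"
    using prod_indicator[of "{1..m} \<times> {1..m}" "edges H" "\<lambda>(i, j). {x i, y j}"]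
    by (simp add: prod.cartesian_product case_prod_unfold indicator_def edge_tuple_graph_iff)
qed

lemma bij_betw_curry_PiE:
  "bij_betw (\<lambda>\<phi>. \<lambda>v\<in>V. \<lambda>i\<in>I. \<phi> (v, i)) (V \<times> I \<rightarrow>\<^sub>E N) (V \<rightarrow>\<^sub>E (I \<rightarrow>\<^sub>E N))"
proof -
  define curried where "curried \<phi> = (\<lambda>v\<in>V. \<lambda>i\<in>I. \<phi> (v, i))" for \<phi> :: "'a \<times> 'b \<Rightarrow> 'c"
  have "bij_betw curried (V \<times> I \<rightarrow>\<^sub>E N) (V \<rightarrow>\<^sub>E (I \<rightarrow>\<^sub>E N))"
  proof (rule bij_betwI[where g = "\<lambda>\<psi>. \<lambda>(v, i)\<in>V \<times> I. \<psi> v i"])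
    show "curried \<in> (V \<times> I \<rightarrow>\<^sub>E N) \<rightarrow> (V \<rightarrow>\<^sub>E (I \<rightarrow>\<^sub>E N))"
      by (auto simp: curried_def)
    show "(\<lambda>\<psi>. \<lambda>(v, i)\<in>V \<times> I. \<psi> v i) \<in> (V \<rightarrow>\<^sub>E (I \<rightarrow>\<^sub>E N)) \<rightarrow> (V \<times> I \<rightarrow>\<^sub>E N)"
      by (fastforce simp: restrict_PiE_iff dest: PiE_mem)
    show "(\<lambda>(v, i)\<in>V \<times> I. curried \<phi> v i) = \<phi>" if "\<phi> \<in> V \<times> I \<rightarrow>\<^sub>E N" for \<phi>
      using that by (auto simp: curried_def fun_eq_iff PiE_iff extensional_def restrict_def)
    show "curried (\<lambda>(v, i)\<in>V \<times> I. \<psi> v i) = \<psi>" if "\<psi> \<in> V \<rightarrow>\<^sub>E (I \<rightarrow>\<^sub>E N)" for \<psi>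
      using that by (fastforce simp: curried_def fun_eq_iff PiE_iff extensional_def restrict_def)
  qed
  then show ?thesis unfolding curried_def .
qed

lemma hom_density_blow_up:
  assumes G: "finite_simple_graph G"
  shows "hom_density (blow_up m G) H = hom_density G (tuple_graph m H)"
proof -
  let ?I = "{1..m}" and ?V = "verts G" and ?N = "verts H"
  let ?curry = "\<lambda>\<phi>. \<lambda>v\<in>?V. \<lambda>i\<in>?I. \<phi> (v, i)"
  note bij = bij_betw_curry_PiE[where V = ?V and I = ?I and N = ?N]
  have hom_iff: "(\<forall>v w. {v, w} \<in> edges G \<longrightarrow> {?curry \<phi> v, ?curry \<phi> w} \<in> edges (tuple_graph m H)) \<longleftrightarrow>
      (\<forall>x y. {x, y} \<in> edges (blow_up m G) \<longrightarrow> {\<phi> x, \<phi> y} \<in> edges H)"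
    if \<phi>: "\<phi> \<in> ?V \<times> ?I \<rightarrow>\<^sub>E ?N" for \<phi>
  proof -
    have "{?curry \<phi> v, ?curry \<phi> w} \<in> edges (tuple_graph m H) \<longleftrightarrow>
        (\<forall>i\<in>?I. \<forall>j\<in>?I. {\<phi> (v, i), \<phi> (w, j)} \<in> edges H)" if vw: "{v, w} \<in> edges G" for v w
    proof -
      have "v \<in> ?V" "w \<in> ?V" using edge_vertsD[OF G vw] by auto
      moreover from this have "?curry \<phi> v \<in> ?I \<rightarrow>\<^sub>E ?N" "?curry \<phi> w \<in> ?I \<rightarrow>\<^sub>E ?N"
        using \<phi> by (auto dest: PiE_mem)
      ultimately show ?thesis by (subst edge_tuple_graph_iff) simp_all
    qed
    then show ?thesis by (auto simp: split_paired_All edge_blow_up_iff)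
  qed
  have verts: "verts (blow_up m G) = ?V \<times> ?I" by (simp add: blow_up_def)
  have "bij_betw ?curry (graph_homs (blow_up m G) H) (graph_homs G (tuple_graph m H))"
    unfolding graph_homs_def verts_tuple_graph verts
    by (rule bij_betw_Collect[OF bij]) (rule hom_iff)
  then show ?thesis
    using bij_betw_same_card[OF bij]
    by (simp add: hom_density_def bij_betw_same_card verts_tuple_graph verts)
qed

lemma sidorenko_blow_up_ge:
  assumes G: "finite_simple_graph G" "sidorenko G"
    and H: "finite_simple_graph H" "verts H \<noteq> {}" and m: "m \<ge> 1"
  shows "biclique_density m m H ^ card (edges G) \<le> hom_density (blow_up m G) H"
  using sidorenkoD[OF G(2,1) finite_simple_graph_tuple_graph[OF H(1) m]] H m
  by (simp add: hom_density_blow_up[OF G(1)] hom_density_K2_tuple_graph verts_tuple_graph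
      PiE_eq_empty_iff)

theorem theorem1p1:
  fixes G :: "'a sgraph" and m :: nat
  assumes "finite_simple_graph G"
    and "edges G \<noteq> {}"
    and "sidorenko G"
    and "m \<ge> 2"
  shows "forcing (blow_up m G)"
proof (rule forcing_if_ge_four_cycle)
  let ?e = "card (edges G)" and ?e' = "card (edges (blow_up m G))"
  show "finite_simple_graph (blow_up m G)"
    using assms(1) by (rule finite_simple_graph_blow_up)
  have "?e' \<noteq> 0"
    using assms by (simp add: card_edges_blow_up finite_edges)
  then show "edges (blow_up m G) \<noteq> {}" by auto
  fix H :: "nat sgraph" assume H: "finite_simple_graph H" "verts H \<noteq> {}"
  have "biclique_density 2 2 H ^ ?e' = (biclique_density 2 2 H ^ (m * m)) ^ ?e"
    using assms(1) by (simp add: card_edges_blow_up power_mult)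
  also have "\<dots> \<le> (biclique_density m m H ^ 4) ^ ?e"
    using biclique_density_power_mean[OF H(1) assms(4,4)]
    by (intro power_mono) (simp_all add: biclique_density_nonneg)
  also have "\<dots> = (biclique_density m m H ^ ?e) ^ 4"
    by (simp add: power_mult[symmetric] mult.commute)
  also have "\<dots> \<le> hom_density (blow_up m G) H ^ 4"
    using assms H by (intro power_mono sidorenko_blow_up_ge) (simp_all add: biclique_density_nonneg)
  finally show "biclique_density 2 2 H ^ ?e' \<le> hom_density (blow_up m G) H ^ 4" .
qed

end
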